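(* Let $c\in[0,1)$ and $0<W_{\min}\le W_{\max}$. Consider all weighted COA robustness instances, i.e. weighted instances $P$ (any $n$) such that every agent is either located at $(0,1)$ with weight $W_{\max}$ or located at $(x,0)$ or $(-x,0)$ with weight $W_{\min}$ for some common $x\ge 0$, $(0,1)$ is an optimal location $o(P)$, and CMP with the (wrong) prediction $\hat o=(0,0)$ outputs $f(P,(0,0),c)=(0,0)$. The worst case (supremum) over all such instances of the approximation ratio $C^u(f(P,(0,0),c),P)/C^u(o(P),P)$ equals $$\frac{\sqrt{(1-c)^2W_{\min}^2+(1+c)^2W_{\max}^2}}{(1-c)W_{\min}}.$$
   Context: Weighted instance: a multiset $P=\{p_1,\dots,p_n\}\subset\mathbb{R}^2$ with weights $w_i>0$; $d$ is Euclidean distance; $C^u(f,P)=\frac1n\sum_i w_i d(f,p_i)$; $o(P)$ is a minimizer of $C^u(\cdot,P)$. The CMP mechanism with confidence $c\in[0,1)$ and prediction $\hat o\in\mathbb{R}^2$: let $m=\lfloor cn\rfloor$, let $P'$ be $P$ together with $m$ copies of $\hat o$, and output $f(P,\hat o,c)=(x_{\mathrm{med}},y_{\mathrm{med}})$, where $x_{\mathrm{med}}$ (resp. $y_{\mathrm{med}}$) is the median of the $x$-coordinates (resp. $y$-coordinates) of the $n+m$ points of $P'$, taking the smaller of the two middle values when $n+m$ is even. CMP does not use the weights. *)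

theory Defs
  imports "HOL-Analysis.Analysis" "HOL-Library.Multiset"
begin

text \<open>A weighted instance is a multiset of agents, each a pair of a location and a weight.
  The metric \<^const>\<open>dist\<close> on \<^typ>\<open>real \<times> real\<close> is the Euclidean one.\<close>

type_synonym point = "real \<times> real"
type_synonym agent = "point \<times> real"

definition weighted_instance :: "agent multiset \<Rightarrow> bool" where
  "weighted_instance P \<longleftrightarrow> P \<noteq> {#} \<and> (\<forall>(p, w) \<in># P. w > 0)"

definition locations :: "agent multiset \<Rightarrow> point multiset" where
  "locations P = image_mset fst P"

definition cost :: "point \<Rightarrow> agent multiset \<Rightarrow> real" where
  "cost f P = (\<Sum>(p, w) \<in># P. w * dist f p) / real (size P)"

definition is_optimal :: "point \<Rightarrow> agent multiset \<Rightarrow> bool" where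
  "is_optimal q P \<longleftrightarrow> is_arg_min (\<lambda>f. cost f P) (\<lambda>_. True) q"

definition opt_location :: "agent multiset \<Rightarrow> point" where
  "opt_location P = arg_min (\<lambda>f. cost f P) (\<lambda>_. True)"

text \<open>For even size \<open>N\<close> the (0-based) index \<open>(N - 1) div 2\<close> is \<open>N / 2 - 1\<close>, i.e. the smaller
  of the two middle values is taken.\<close>

definition lower_median :: "real multiset \<Rightarrow> real" where
  "lower_median A = sorted_list_of_multiset A ! ((size A - 1) div 2)"

text \<open>The mechanism sees only the locations, not the weights.\<close>

definition cmp_outcome :: "point multiset \<Rightarrow> point \<Rightarrow> real \<Rightarrow> point" where
  "cmp_outcome L pred c =
    (let L' = L + replicate_mset (nat \<lfloor>c * real (size L)\<rfloor>) pred
     in (lower_median (image_mset fst L'), lower_median (image_mset snd L')))"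

text \<open>The ratio is formed in \<^typ>\<open>ereal\<close>, so that a positive cost against a zero optimum
  would count as \<open>\<infinity>\<close>.\<close>

definition approx_ratio :: "point \<Rightarrow> agent multiset \<Rightarrow> ereal" where
  "approx_ratio f P = ereal (cost f P) / ereal (cost (opt_location P) P)"

definition coa_robustness_instance :: "real \<Rightarrow> real \<Rightarrow> real \<Rightarrow> agent multiset \<Rightarrow> bool" where
  "coa_robustness_instance c Wmin Wmax P \<longleftrightarrow>
     weighted_instance P \<and>
     (\<exists>x\<ge>0. \<forall>(p, w) \<in># P.
        p = (0, 1) \<and> w = Wmax \<or> (p = (x, 0) \<or> p = (-x, 0)) \<and> w = Wmin) \<and>
     is_optimal (0, 1) P \<and>
     cmp_outcome (locations P) (0, 0) c = (0, 0)"

end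

theory Submission imports Defs begin

text \<open>
  Let \<open>k\<close> agents sit at \<open>(0, 1)\<close>, \<open>s\<close> agents at \<open>(x, 0)\<close> or \<open>(-x, 0)\<close>, and put
  \<open>r = k * Wmax / (s * Wmin)\<close>. The ratio is \<open>(r + x) / sqrt (1 + x\<^sup>2)\<close>, which by Cauchy-Schwarz
  is at most \<open>sqrt (1 + r\<^sup>2)\<close>, with equality at \<open>x = 1 / r\<close>. The \<open>y\<close>-median is \<open>0\<close> iff
  \<open>k \<le> s + m\<close>, that is, iff \<open>(1 - c) * k \<le> (1 + c) * s\<close>, which bounds \<open>r\<close>. Conversely, splitting
  an even \<open>s\<close> evenly between the two sites on the \<open>x\<close>-axis keeps \<open>(0, 1)\<close> optimal, and
  \<open>k / s\<close> can be chosen arbitrarily close to \<open>(1 + c) / (1 - c)\<close>.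
\<close>

section \<open>Multisets with few distinct values and their lower medians\<close>

text \<open>Reduces an instance to its three counts. The elements may coincide, so
  \<open>x = 0\<close>, where the two sites on the axis merge, is covered as well.\<close>

lemma mset_subset_three:
  assumes "set_mset M \<subseteq> {u, v, w}"
  shows "\<exists>k a b. M = replicate_mset k u + replicate_mset a v + replicate_mset b w"
  using assms
proof (induction M)
  case empty
  show ?case by (intro exI[of _ 0]) simp
next
  case (add z M)
  then obtain k a b
    where M: "M = replicate_mset k u + replicate_mset a v + replicate_mset b w"
    by auto
  from add.prems consider "z = u" | "z = v" | "z = w" by auto
  then show ?case
  proof cases
    case 1
    then show ?thesis
      unfolding M by (intro exI[of _ "Suc k"] exI[of _ a] exI[of _ b]) simp
  next
    case 2
    then show ?thesis
      unfolding M by (intro exI[of _ k] exI[of _ "Suc a"] exI[of _ b]) simp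
  next
    case 3
    then show ?thesis
      unfolding M by (intro exI[of _ k] exI[of _ a] exI[of _ "Suc b"]) simp
  qed
qed

lemma replicate_mset_add: "replicate_mset (m + n) x = replicate_mset m x + replicate_mset n x"
  by (induction m) auto

lemma lower_median_three:
  assumes "u \<le> v" and "v \<le> w"
  shows "lower_median (replicate_mset a u + replicate_mset b v + replicate_mset d w)
    = (replicate a u @ replicate b v @ replicate d w) ! ((a + b + d - 1) div 2)"
proof -
  let ?xs = "replicate a u @ replicate b v @ replicate d w"
  have "sorted ?xs"
    using assms by (auto simp: sorted_append)
  moreover have "mset ?xs = replicate_mset a u + replicate_mset b v + replicate_mset d w"
    by simp
  ultimately have "sorted_list_of_multiset
      (replicate_mset a u + replicate_mset b v + replicate_mset d w) = ?xs"
    by (metis sorted_list_of_multiset_mset sorted_sort_id)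
  then show ?thesis
    by (simp add: lower_median_def)
qed

lemma lower_median_zero_one:
  assumes "0 < j + k"
  shows "lower_median (replicate_mset j 0 + replicate_mset k 1) = 0 \<longleftrightarrow> k \<le> j"
proof -
  \<comment> \<open>The first of the three blocks is taken empty.\<close>
  have "lower_median (replicate_mset j 0 + replicate_mset k 1)
      = (replicate j 0 @ replicate k 1) ! ((j + k - 1) div 2)"
    using lower_median_three[of 0 0 1 0 j k] by simp
  \<comment> \<open>A tie \<open>j = k\<close> gives index \<open>j - 1\<close>, still in the block
    of zeros: this is the effect of taking the smaller middle value.\<close>
  also have "\<dots> = (if (j + k - 1) div 2 < j then 0 else 1)"
    using assms by (auto simp: nth_append)
  finally show ?thesis
    using assms by auto
qed

text \<open>The median index is \<open>a + (b - 1) div 2\<close>, which lies in the middle block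
  because \<open>b\<close> is positive.\<close>

lemma lower_median_symmetric:
  assumes "0 \<le> x" and "0 < b"
  shows "lower_median (replicate_mset a (- x) + replicate_mset b 0 + replicate_mset a x) = 0"
  using assms by (subst lower_median_three) (auto simp: nth_append)

section \<open>Costs and approximation ratio of an instance\<close>

text \<open>\<open>opt_location\<close> is a choice among the minimizers and may differ from
  \<open>q\<close>, but all minimizers have the same cost.\<close>

lemma approx_ratio_optimal:
  assumes "is_optimal q P"
  shows "approx_ratio f P = ereal (cost f P) / ereal (cost q P)"
proof -
  have opt: "is_arg_min (\<lambda>f. cost f P) (\<lambda>_. True) q"
    using assms by (simp add: is_optimal_def)
  then have "is_arg_min (\<lambda>f. cost f P) (\<lambda>_. True) (opt_location P)"
    unfolding opt_location_def arg_min_def by (rule someI)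
  with opt have "cost (opt_location P) P = cost q P"
    unfolding is_arg_min_linorder by (intro order_antisym) blast+
  then show ?thesis
    by (simp add: approx_ratio_def)
qed

definition coa_agents :: "real \<Rightarrow> real \<Rightarrow> real \<Rightarrow> nat \<Rightarrow> nat \<Rightarrow> nat \<Rightarrow> agent multiset" where
  "coa_agents Wmin Wmax x k a b =
     replicate_mset k ((0, 1), Wmax) + replicate_mset a ((x, 0), Wmin)
     + replicate_mset b ((- x, 0), Wmin)"

lemma size_coa_agents [simp]: "size (coa_agents Wmin Wmax x k a b) = k + a + b"
  by (simp add: coa_agents_def)

lemma cost_coa_agents:
  "cost f (coa_agents Wmin Wmax x k a b)
   = (real k * Wmax * dist f (0, 1) + real a * Wmin * dist f (x, 0)
      + real b * Wmin * dist f (- x, 0)) / real (k + a + b)"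
  by (simp add: cost_def coa_agents_def)

lemma cost_coa_agents_origin:
  assumes "0 \<le> x"
  shows "cost (0, 0) (coa_agents Wmin Wmax x k a b)
    = (real k * Wmax + real (a + b) * Wmin * x) / real (k + a + b)"
  using assms by (simp add: cost_coa_agents dist_Pair_Pair dist_real_def algebra_simps)

lemma cost_coa_agents_apex:
  "cost (0, 1) (coa_agents Wmin Wmax x k a b)
    = real (a + b) * Wmin * sqrt (1 + x\<^sup>2) / real (k + a + b)"
  by (simp add: cost_coa_agents dist_Pair_Pair dist_real_def algebra_simps)

lemma ratio_coa_agents:
  assumes "is_optimal (0, 1) (coa_agents Wmin Wmax x k a b)"
    and "0 \<le> x" and "0 < a + b" and "0 < Wmin"
  shows "approx_ratio (0, 0) (coa_agents Wmin Wmax x k a b)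
    = ereal ((real k * Wmax / (real (a + b) * Wmin) + x) / sqrt (1 + x\<^sup>2))"
proof -
  have "0 < sqrt (1 + x\<^sup>2)"
    by (simp add: add_pos_nonneg)
  moreover have "0 < real (a + b) * Wmin" "0 < real (k + a + b)"
    using assms by auto
  \<comment> \<open>\<open>K\<close> and \<open>S\<close> are the total weights at
    \<open>(0, 1)\<close> and on the axis, \<open>N\<close> is the number of agents, and
    \<open>L\<close> is the distance from \<open>(0, 1)\<close> to either site on the axis.\<close>
  moreover have "(K + S * x) / N / (S * L / N) = (K / S + x) / L"
    if "0 < L" "0 < S" "0 < N" for K S N L :: real
    using that by (simp add: field_simps)
  ultimately have "cost (0, 0) (coa_agents Wmin Wmax x k a b)
        / cost (0, 1) (coa_agents Wmin Wmax x k a b)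
      = (real k * Wmax / (real (a + b) * Wmin) + x) / sqrt (1 + x\<^sup>2)"
    unfolding cost_coa_agents_origin[OF assms(2)] cost_coa_agents_apex by blast
  \<comment> \<open>With a nonzero denominator, division in \<open>ereal\<close> agrees with real
    division.\<close>
  moreover have "cost (0, 1) (coa_agents Wmin Wmax x k a b) \<noteq> 0"
    using \<open>0 < sqrt (1 + x\<^sup>2)\<close> \<open>0 < real (a + b) * Wmin\<close> \<open>0 < real (k + a + b)\<close>
    unfolding cost_coa_agents_apex by (metis divide_eq_0_iff less_irrefl mult_eq_0_iff)
  ultimately show ?thesis
    by (simp add: approx_ratio_optimal[OF assms(1)])
qed

section \<open>The outcome of CMP\<close>

lemma cmp_outcome_coa_agents:
  fixes c Wmin Wmax x :: real and k a b :: nat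
  defines "m \<equiv> nat \<lfloor>c * real (k + a + b)\<rfloor>"
  shows "cmp_outcome (locations (coa_agents Wmin Wmax x k a b)) (0, 0) c
    = (lower_median (replicate_mset b (- x) + replicate_mset (k + m) 0 + replicate_mset a x),
       lower_median (replicate_mset (a + b + m) 0 + replicate_mset k 1))"
proof -
  have "image_mset fst (locations (coa_agents Wmin Wmax x k a b) + replicate_mset m (0, 0))
      = replicate_mset b (- x) + replicate_mset (k + m) 0 + replicate_mset a x"
    by (simp add: locations_def coa_agents_def replicate_mset_add)
  moreover
  have "image_mset snd (locations (coa_agents Wmin Wmax x k a b) + replicate_mset m (0, 0))
      = replicate_mset (a + b + m) 0 + replicate_mset k 1"
    by (simp add: locations_def coa_agents_def replicate_mset_add)
  moreover have "size (locations (coa_agents Wmin Wmax x k a b)) = k + a + b"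
    by (simp add: locations_def)
  ultimately show ?thesis
    by (simp add: cmp_outcome_def Let_def m_def)
qed

text \<open>Since \<open>k - s\<close> is an integer, it is below the floor iff it is below
  \<open>c * (k + s)\<close> itself, so rounding \<open>m\<close> down costs nothing.\<close>

lemma le_add_floor_iff:
  fixes c :: real
  assumes "0 \<le> c"
  shows "k \<le> s + nat \<lfloor>c * real (k + s)\<rfloor> \<longleftrightarrow> (1 - c) * real k \<le> (1 + c) * real s"
proof -
  \<comment> \<open>Hence \<open>nat\<close> does not truncate.\<close>
  have "0 \<le> \<lfloor>c * real (k + s)\<rfloor>"
    using assms by simp
  then have "k \<le> s + nat \<lfloor>c * real (k + s)\<rfloor> \<longleftrightarrow> int k - int s \<le> \<lfloor>c * real (k + s)\<rfloor>"
    by linarith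
  also have "\<dots> \<longleftrightarrow> real k - real s \<le> c * real (k + s)"
    by (simp add: le_floor_iff)
  also have "\<dots> \<longleftrightarrow> (1 - c) * real k \<le> (1 + c) * real s"
    by (simp add: algebra_simps)
  finally show ?thesis .
qed

text \<open>Source of the factor \<open>(1 + c) / (1 - c)\<close>: for \<open>c < 1\<close> it is
  the largest ratio of agents at \<open>(0, 1)\<close> to agents on the axis that the median
  tolerates.\<close>

lemma snd_cmp_outcome_coa_agents_eq_0_iff:
  assumes "0 \<le> c" and "0 < k + a + b"
  shows "snd (cmp_outcome (locations (coa_agents Wmin Wmax x k a b)) (0, 0) c) = 0
    \<longleftrightarrow> (1 - c) * real k \<le> (1 + c) * real (a + b)"
proof -
  let ?m = "nat \<lfloor>c * real (k + a + b)\<rfloor>"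
  have "lower_median (replicate_mset (a + b + ?m) 0 + replicate_mset k 1) = 0
      \<longleftrightarrow> k \<le> a + b + ?m"
    using assms by (intro lower_median_zero_one) linarith
  then show ?thesis
    using le_add_floor_iff[OF \<open>0 \<le> c\<close>, of k "a + b"]
    by (simp only: cmp_outcome_coa_agents snd_conv add.assoc)
qed

section \<open>Upper bound on the ratio\<close>

lemma cauchy_schwarz_one: "r + x \<le> sqrt (1 + r\<^sup>2) * sqrt (1 + x\<^sup>2)" for r x :: real
proof -
  \<comment> \<open>This square is exactly the difference of the two sides of the squared
    inequality.\<close>
  have "0 \<le> (r * x - 1)\<^sup>2"
    by simp
  then have "(r + x)\<^sup>2 \<le> (1 + r\<^sup>2) * (1 + x\<^sup>2)"
    by (simp add: power2_eq_square algebra_simps)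
  then show ?thesis
    by (metis real_le_rsqrt real_sqrt_mult)
qed

lemma coa_instance_ratio_le:
  fixes c Wmin Wmax :: real
  assumes "0 \<le> c" and "c < 1" and "0 < Wmin" and "0 < Wmax"
    and P: "coa_robustness_instance c Wmin Wmax P"
  shows "approx_ratio (cmp_outcome (locations P) (0, 0) c) P
    \<le> ereal (sqrt (1 + ((1 + c) * Wmax / ((1 - c) * Wmin))\<^sup>2))"
proof -
  from P obtain x where x: "0 \<le> x"
    and agents: "\<forall>(p, w) \<in># P.
        p = (0, 1) \<and> w = Wmax \<or> (p = (x, 0) \<or> p = (- x, 0)) \<and> w = Wmin"
    unfolding coa_robustness_instance_def by blast
  from agents have "set_mset P \<subseteq> {((0, 1), Wmax), ((x, 0), Wmin), ((- x, 0), Wmin)}"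
    by auto
  then obtain k a b where Pk: "P = coa_agents Wmin Wmax x k a b"
    unfolding coa_agents_def by (metis mset_subset_three)
  from P have opt: "is_optimal (0, 1) P" and out: "cmp_outcome (locations P) (0, 0) c = (0, 0)"
    and "P \<noteq> {#}"
    by (auto simp: coa_robustness_instance_def weighted_instance_def)
  then have pos: "0 < k + a + b"
    by (metis Pk size_coa_agents nonempty_has_size)
  have med: "(1 - c) * real k \<le> (1 + c) * real (a + b)"
    using snd_cmp_outcome_coa_agents_eq_0_iff[OF \<open>0 \<le> c\<close> pos] out Pk by (metis snd_conv)
  \<comment> \<open>With no agents on the axis, \<open>med\<close> would force \<open>k = 0\<close>
    and the instance would be empty.\<close>
  have s: "0 < a + b"
  proof (rule ccontr)
    assume "\<not> 0 < a + b"
    then have "0 < k" "(1 - c) * real k \<le> 0"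
      using pos med by auto
    then show False
      using \<open>c < 1\<close> by (simp add: mult_le_0_iff)
  qed
  \<comment> \<open>\<open>r\<close> is the weight at \<open>(0, 1)\<close> relative to the weight
    on the axis; \<open>R\<close> is the bound that \<open>med\<close> puts on it.\<close>
  define r where "r = real k * Wmax / (real (a + b) * Wmin)"
  define R where "R = (1 + c) * Wmax / ((1 - c) * Wmin)"
  have "((1 - c) * real k) * (Wmax * Wmin) \<le> ((1 + c) * real (a + b)) * (Wmax * Wmin)"
    using med \<open>0 < Wmin\<close> \<open>0 < Wmax\<close> by (intro mult_right_mono) auto
  moreover have "0 < real (a + b) * Wmin" "0 < (1 - c) * Wmin"
    using s assms by auto
  ultimately have "r \<le> R"
    unfolding r_def R_def by (simp add: divide_le_eq pos_le_divide_eq algebra_simps)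
  moreover have "0 \<le> r"
    using \<open>0 < Wmax\<close> \<open>0 < Wmin\<close> by (simp add: r_def)
  ultimately have "sqrt (1 + r\<^sup>2) \<le> sqrt (1 + R\<^sup>2)"
    by (simp add: power_mono)
  moreover have "(r + x) / sqrt (1 + x\<^sup>2) \<le> sqrt (1 + r\<^sup>2)"
    using cauchy_schwarz_one[of r x] by (simp add: divide_le_eq add_pos_nonneg)
  ultimately have "(r + x) / sqrt (1 + x\<^sup>2) \<le> sqrt (1 + R\<^sup>2)"
    by linarith
  then show ?thesis
    using ratio_coa_agents[of Wmin Wmax x k a b] opt x s \<open>0 < Wmin\<close> out
    by (simp add: Pk r_def R_def)
qed

section \<open>Optimality of the point (0, 1)\<close>

text \<open>The sum of the two distances is convex in \<open>f\<close>, with value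
  \<open>2 * L\<close> and gradient \<open>(0, 2 / L)\<close> at \<open>(0, 1)\<close>. The bound is
  its tangent there, weakened by replacing the vertical displacement with the distance.\<close>

lemma sum_dist_symmetric_ge:
  fixes f :: point and x :: real
  defines "L \<equiv> sqrt (1 + x\<^sup>2)"
  shows "2 * L - 2 / L * dist f (0, 1) \<le> dist f (x, 0) + dist f (- x, 0)"
proof -
  obtain u v where f: "f = (u, v)"
    by force
  have L: "0 < L" "L\<^sup>2 = 1 + x\<^sup>2"
    by (simp_all add: L_def add_pos_nonneg)
  \<comment> \<open>Reflecting the second difference vector in the vertical axis makes
    \<open>u\<close> cancel, which amounts to projecting \<open>f\<close> to
    \<open>(0, v)\<close>.\<close>
  have "norm ((u - x, v) + (- (u + x), v)) \<le> norm (u - x, v) + norm (- (u + x), v)"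
    by (rule norm_triangle_ineq)
  moreover have "norm ((u - x, v) + (- (u + x), v)) = 2 * sqrt (x\<^sup>2 + v\<^sup>2)"
  proof -
    have "norm ((u - x, v) + (- (u + x), v)) = sqrt (4 * (x\<^sup>2 + v\<^sup>2))"
      by (simp add: norm_Pair power2_eq_square algebra_simps)
    then show ?thesis
      by (simp only: real_sqrt_mult real_sqrt_four)
  qed
  moreover have "norm (u - x, v) = dist f (x, 0)" "norm (- (u + x), v) = dist f (- x, 0)"
    by (simp_all add: f norm_Pair dist_Pair_Pair dist_real_def power2_eq_square algebra_simps)
  ultimately have sum: "2 * sqrt (x\<^sup>2 + v\<^sup>2) \<le> dist f (x, 0) + dist f (- x, 0)"
    by linarith
  \<comment> \<open>Cauchy-Schwarz for \<open>(x, v)\<close> and \<open>(x, 1)\<close>; this product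
    is the defect.\<close>
  have "0 \<le> x\<^sup>2 * (v - 1)\<^sup>2"
    by simp
  then have "(x\<^sup>2 + v)\<^sup>2 \<le> (x\<^sup>2 + v\<^sup>2) * (1 + x\<^sup>2)"
    by (simp add: power2_eq_square algebra_simps)
  then have "x\<^sup>2 + v \<le> sqrt (x\<^sup>2 + v\<^sup>2) * L"
    unfolding L_def by (metis real_le_rsqrt real_sqrt_mult)
  moreover have "1 - v \<le> dist f (0, 1)"
  proof -
    have "\<bar>v - 1\<bar> \<le> dist f (0, 1)"
      using dist_snd_le[of f "(0, 1)"] by (simp add: f dist_real_def)
    then show ?thesis by linarith
  qed
  ultimately have "L\<^sup>2 - dist f (0, 1) \<le> sqrt (x\<^sup>2 + v\<^sup>2) * L"
    using L(2) by linarith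
  then have "(L\<^sup>2 - dist f (0, 1)) / L \<le> sqrt (x\<^sup>2 + v\<^sup>2)"
    using L(1) by (simp add: divide_le_eq)
  moreover have "(L\<^sup>2 - dist f (0, 1)) / L = L - dist f (0, 1) / L"
    using L(1) by (simp add: diff_divide_distrib power2_eq_square)
  ultimately show ?thesis
    using sum by simp
qed

text \<open>Subgradient condition: the joint pull \<open>2 * a * Wmin / L\<close> of the axis agents
  does not exceed the weight \<open>k * Wmax\<close> that holds the minimizer at
  \<open>(0, 1)\<close>.\<close>

lemma is_optimal_apex:
  fixes Wmin Wmax x :: real and k a :: nat
  assumes "0 \<le> Wmin" and "2 * real a * Wmin \<le> real k * Wmax * sqrt (1 + x\<^sup>2)"
  shows "is_optimal (0, 1) (coa_agents Wmin Wmax x k a a)"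
proof -
  let ?P = "coa_agents Wmin Wmax x k a a"
  define L where "L = sqrt (1 + x\<^sup>2)"
  have L: "0 < L"
    by (simp add: L_def add_pos_nonneg)
  have "cost (0, 1) ?P \<le> cost f ?P" for f
  proof -
    let ?d = "dist f (0, 1)"
    have "2 * real a * Wmin / L \<le> real k * Wmax"
      using assms(2) L by (simp add: L_def divide_le_eq)
    then have "2 * real a * Wmin / L * ?d \<le> real k * Wmax * ?d"
      by (intro mult_right_mono) auto
    moreover have "real a * Wmin * (2 * L - 2 / L * ?d)
        \<le> real a * Wmin * (dist f (x, 0) + dist f (- x, 0))"
      unfolding L_def using assms(1) by (intro mult_left_mono sum_dist_symmetric_ge) auto
    ultimately have "real (a + a) * Wmin * L
        \<le> real k * Wmax * ?d + real a * Wmin * dist f (x, 0) + real a * Wmin * dist f (- x, 0)"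
      by (simp add: algebra_simps)
    then show ?thesis
      unfolding cost_coa_agents_apex cost_coa_agents[of f] L_def[symmetric]
      by (rule divide_right_mono) simp
  qed
  then show ?thesis
    by (simp add: is_optimal_def is_arg_min_linorder)
qed

section \<open>Extremal instances\<close>

text \<open>Equal counts on both sides cancel the horizontal pull, and \<open>x = 1 / r\<close> is
  the equality case of Cauchy-Schwarz.\<close>

lemma coa_instance_extremal:
  fixes c Wmin Wmax :: real and k a :: nat
  assumes "0 \<le> c" and "0 < Wmin" and "0 < Wmax" and "0 < a" and "0 < k"
    and med: "(1 - c) * real k \<le> (1 + c) * real (2 * a)"
  defines "r \<equiv> real k * Wmax / (real (2 * a) * Wmin)"
  shows "coa_robustness_instance c Wmin Wmax (coa_agents Wmin Wmax (1 / r) k a a)" (is ?inst)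
    and "approx_ratio (cmp_outcome (locations (coa_agents Wmin Wmax (1 / r) k a a)) (0, 0) c)
           (coa_agents Wmin Wmax (1 / r) k a a) = ereal (sqrt (1 + r\<^sup>2))" (is ?ratio)
proof -
  let ?P = "coa_agents Wmin Wmax (1 / r) k a a"
  have r: "0 < r"
    using assms by (simp add: r_def)
  have L: "sqrt (1 + (1 / r)\<^sup>2) = sqrt (1 + r\<^sup>2) / r"
  proof -
    have "1 + (1 / r)\<^sup>2 = (1 + r\<^sup>2) / r\<^sup>2"
      using r by (simp add: field_simps)
    then show ?thesis
      using r by (simp add: real_sqrt_divide)
  qed
  have W: "real k * Wmax = 2 * real a * Wmin * r"
    using assms by (simp add: r_def)
  \<comment> \<open>After substituting \<open>W\<close> and \<open>L\<close>, the optimality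
    condition is just \<open>1 \<le> sqrt (1 + r\<^sup>2)\<close>.\<close>
  have "2 * real a * Wmin * 1 \<le> 2 * real a * Wmin * sqrt (1 + r\<^sup>2)"
    using assms(2) by (intro mult_left_mono) auto
  also have "\<dots> = real k * Wmax * sqrt (1 + (1 / r)\<^sup>2)"
    unfolding W L using r by simp
  finally have "2 * real a * Wmin \<le> real k * Wmax * sqrt (1 + (1 / r)\<^sup>2)"
    by simp
  then have opt: "is_optimal (0, 1) ?P"
    using \<open>0 < Wmin\<close> by (intro is_optimal_apex) simp_all
  have "snd (cmp_outcome (locations ?P) (0, 0) c) = 0"
    using snd_cmp_outcome_coa_agents_eq_0_iff[OF \<open>0 \<le> c\<close>, of k a a] med \<open>0 < k\<close>
    by (metis add_gr_0 mult_2)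
  \<comment> \<open>The agents at \<open>(0, 1)\<close> have \<open>x\<close>-coordinate
    \<open>0\<close>, so \<open>0 < k\<close> makes the middle block nonempty.\<close>
  moreover have "fst (cmp_outcome (locations ?P) (0, 0) c) = 0"
    using r \<open>0 < k\<close> by (simp add: cmp_outcome_coa_agents lower_median_symmetric)
  ultimately have out: "cmp_outcome (locations ?P) (0, 0) c = (0, 0)"
    by (simp add: prod_eq_iff)
  have "?P \<noteq> {#}"
    using \<open>0 < k\<close> by (auto simp: coa_agents_def)
  then have "weighted_instance ?P"
    using assms by (auto simp: weighted_instance_def coa_agents_def split: if_splits)
  moreover have "\<exists>x\<ge>0. \<forall>(p, w) \<in># ?P.
      p = (0, 1) \<and> w = Wmax \<or> (p = (x, 0) \<or> p = (- x, 0)) \<and> w = Wmin"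
    using r by (intro exI[of _ "1 / r"]) (auto simp: coa_agents_def split: if_splits)
  ultimately show ?inst
    using opt out by (simp add: coa_robustness_instance_def)
  have "r + 1 / r = (1 + r\<^sup>2) / r"
    using r by (simp add: field_simps power2_eq_square)
  then have "(r + 1 / r) / (sqrt (1 + r\<^sup>2) / r) = (1 + r\<^sup>2) / sqrt (1 + r\<^sup>2)"
    using r by simp
  also have "\<dots> = sqrt (1 + r\<^sup>2)"
    by (intro real_div_sqrt) simp
  finally have "(r + 1 / r) / sqrt (1 + (1 / r)\<^sup>2) = sqrt (1 + r\<^sup>2)"
    unfolding L .
  moreover have "approx_ratio (0, 0) ?P = ereal ((r + 1 / r) / sqrt (1 + (1 / r)\<^sup>2))"
    using ratio_coa_agents[OF opt _ _ \<open>0 < Wmin\<close>] r \<open>0 < a\<close>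
    by (simp only: r_def[unfolded mult_2, symmetric]) simp
  ultimately show ?ratio
    unfolding out by simp
qed

section \<open>Approaching the supremum\<close>

lemma tendsto_floor_scaled:
  fixes t :: real
  shows "(\<lambda>j. of_int \<lfloor>t * real (2 * Suc j)\<rfloor> / real (2 * Suc j)) \<longlonglongrightarrow> t"
proof (rule tendsto_sandwich)
  show "\<forall>\<^sub>F j in sequentially.
      t - 1 / real (Suc j) \<le> of_int \<lfloor>t * real (2 * Suc j)\<rfloor> / real (2 * Suc j)"
  proof (intro always_eventually allI)
    fix j
    let ?s = "real (2 * Suc j)"
    \<comment> \<open>Slack \<open>2\<close> instead of \<open>1\<close> turns the error into
      exactly \<open>1 / Suc j\<close>.\<close>
    have "t * ?s - 2 \<le> of_int \<lfloor>t * ?s\<rfloor>"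
      by linarith
    then have "(t * ?s - 2) / ?s \<le> of_int \<lfloor>t * ?s\<rfloor> / ?s"
      by (intro divide_right_mono) auto
    moreover have "(t * ?s - 2) / ?s = t - 1 / real (Suc j)"
      by (simp add: field_simps)
    ultimately show "t - 1 / real (Suc j) \<le> of_int \<lfloor>t * ?s\<rfloor> / ?s"
      by simp
  qed
  show "\<forall>\<^sub>F j in sequentially. of_int \<lfloor>t * real (2 * Suc j)\<rfloor> / real (2 * Suc j) \<le> t"
    by (intro always_eventually allI) (simp only: divide_le_eq, simp)
  show "(\<lambda>j. t - 1 / real (Suc j)) \<longlonglongrightarrow> t"
    using tendsto_diff[OF tendsto_const[of t] LIMSEQ_inverse_real_of_nat]
    by (simp add: inverse_eq_divide)
qed simp

theorem theorem6:
  fixes c Wmin Wmax :: real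
  assumes "0 \<le> c" and "c < 1" and "0 < Wmin" and "Wmin \<le> Wmax"
  shows "(SUP P \<in> {P. coa_robustness_instance c Wmin Wmax P}.
            approx_ratio (cmp_outcome (locations P) (0, 0) c) P)
         = ereal (sqrt ((1 - c)\<^sup>2 * Wmin\<^sup>2 + (1 + c)\<^sup>2 * Wmax\<^sup>2) / ((1 - c) * Wmin))"
proof -
  define t where "t = (1 + c) / (1 - c)"
  define R where "R = (1 + c) * Wmax / ((1 - c) * Wmin)"
  let ?I = "{P. coa_robustness_instance c Wmin Wmax P}"
  let ?ratio = "\<lambda>P. approx_ratio (cmp_outcome (locations P) (0, 0) c) P"
  have "0 < Wmax"
    using assms by linarith
  have D: "0 < (1 - c) * Wmin"
    using assms by simp
  have t: "1 \<le> t" "(1 - c) * t = 1 + c"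
    using assms by (simp_all add: t_def)
  have "sqrt (1 + R\<^sup>2)
      = sqrt (((1 - c)\<^sup>2 * Wmin\<^sup>2 + (1 + c)\<^sup>2 * Wmax\<^sup>2) / ((1 - c) * Wmin)\<^sup>2)"
    using assms by (simp add: R_def power_divide power_mult_distrib add_divide_distrib)
  also have "\<dots> = sqrt ((1 - c)\<^sup>2 * Wmin\<^sup>2 + (1 + c)\<^sup>2 * Wmax\<^sup>2) / ((1 - c) * Wmin)"
    using D by (simp only: real_sqrt_divide real_sqrt_abs abs_of_pos)
  finally have val: "sqrt (1 + R\<^sup>2)
      = sqrt ((1 - c)\<^sup>2 * Wmin\<^sup>2 + (1 + c)\<^sup>2 * Wmax\<^sup>2) / ((1 - c) * Wmin)" .
  have "(SUP P \<in> ?I. ?ratio P) = ereal (sqrt (1 + R\<^sup>2))"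
  proof (rule antisym)
    show "(SUP P \<in> ?I. ?ratio P) \<le> ereal (sqrt (1 + R\<^sup>2))"
      unfolding R_def using assms \<open>0 < Wmax\<close> by (intro SUP_least coa_instance_ratio_le) auto
    \<comment> \<open>The largest count at \<open>(0, 1)\<close> that the median allows against
      \<open>2 * Suc j\<close> agents on the axis, a number that is even and positive.\<close>
    define k where "k j = nat \<lfloor>t * real (2 * Suc j)\<rfloor>" for j
    define r where "r j = real (k j) * Wmax / (real (2 * Suc j) * Wmin)" for j
    have k: "real (k j) = of_int \<lfloor>t * real (2 * Suc j)\<rfloor>" for j
      using t(1) by (simp add: k_def)
    have kpos: "0 < k j" for j
    proof -
      have "1 * 1 \<le> t * real (2 * Suc j)"
        using t(1) by (intro mult_mono) auto
      then show ?thesis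
        by (simp add: k_def)
    qed
    have med: "(1 - c) * real (k j) \<le> (1 + c) * real (2 * Suc j)" for j
    proof -
      have "(1 - c) * real (k j) \<le> (1 - c) * (t * real (2 * Suc j))"
        unfolding k using assms by (intro mult_left_mono) auto
      then show ?thesis
        by (metis mult.assoc t(2))
    qed
    \<comment> \<open>A limit is taken because \<open>t\<close> may be irrational, in which case no
      quotient of counts equals it.\<close>
    have "ereal (sqrt (1 + (r j)\<^sup>2)) \<le> (SUP P \<in> ?I. ?ratio P)" for j
      using coa_instance_extremal[OF \<open>0 \<le> c\<close> \<open>0 < Wmin\<close> \<open>0 < Wmax\<close> _ kpos med]
      unfolding r_def by (intro SUP_upper2) auto
    moreover have "(\<lambda>j. ereal (sqrt (1 + (r j)\<^sup>2))) \<longlonglongrightarrow> ereal (sqrt (1 + R\<^sup>2))"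
    proof -
      have "(\<lambda>j. real (k j) / real (2 * Suc j) * (Wmax / Wmin)) \<longlonglongrightarrow> t * (Wmax / Wmin)"
        unfolding k by (intro tendsto_mult tendsto_floor_scaled tendsto_const)
      then have "r \<longlonglongrightarrow> R"
        by (simp add: r_def[abs_def] R_def t_def)
      then show ?thesis
        by (intro tendsto_intros)
    qed
    ultimately show "ereal (sqrt (1 + R\<^sup>2)) \<le> (SUP P \<in> ?I. ?ratio P)"
      using LIMSEQ_le_const2 by blast
  qed
  then show ?thesis
    unfolding val .
qed

end
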